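(* Let $n\ge 3$ be an integer. The following hold. (1) For every integer $m\ge 1$, the string $S_m$ contains exactly $F_{n,m}$ letters, of which exactly $F_{n,m-(n-1)}$ are $a_n$'s and, for each $1\le i\le n-1$, exactly $F_{n,m-(n+i-1)}$ are $a_i$'s (that is, $F_{n,m-n}$ are $a_1$'s, $F_{n,m-(n+1)}$ are $a_2$'s, ..., $F_{n,m-(2n-2)}$ are $a_{n-1}$'s). (2) For every integer $m\ge 1$, the concatenation $$S_{n+(n-1)m}\circ S_{n+(n-1)(m-1)}\circ\cdots\circ S_{n+(n-1)}\circ S_n$$ is equal to the string of the first $F_{n,n}+F_{n,2n-1}+\cdots+F_{n,(m+1)n-m}=\sum_{t=0}^{m}F_{n,n+(n-1)t}$ letters of $S_\infty$.
   Context: For an integer $n\ge 2$, define $F_{n,1}=F_{n,2}=\cdots=F_{n,n}=1$ and $F_{n,m+1}=F_{n,m}+F_{n,m+1-n}$ for all $m\ge n$. The sequence is extended to nonpositive indices by requiring the same recurrence to hold for all integer indices, i.e. $F_{n,m}=F_{n,m+n}-F_{n,m+n-1}$ for $m\le 0$. Let $a_1,\dots,a_n$ be distinct letters and let $\circ$ denote concatenation of strings. Define $S_1=a_1,\dots,S_n=a_n$ (one-letter strings) and $S_m=S_{m-1}\circ S_{m-n}$ for $m\ge n+1$. For $m\ge n$, $S_m$ is a prefix of $S_{m+1}$, and $S_\infty$ (the $n$-string) is the infinite string having every $S_m$, $m\ge n$, as a prefix. *)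

theory Defs
  imports Main "HOL-Library.Stream" "HOL-Library.Sublist"
begin

text \<open>
  The two-sided sequence \<open>F\<^sub>n\<^sub>,\<^sub>m\<close> for \<open>n \<ge> 2\<close>; the second argument ranges over all
  integers. The value for \<open>n < 2\<close> is a dummy that makes the recursion terminate.
  That the recurrence holds at every integer index is \<open>nfib_rec\<close> below.
\<close>

function nfib :: "nat \<Rightarrow> int \<Rightarrow> int" where
  "nfib n m =
    (if n < 2 then 0
     else if 1 \<le> m \<and> m \<le> int n then 1
     else if m > int n then nfib n (m - 1) + nfib n (m - int n)
     else nfib n (m + int n) - nfib n (m + int n - 1))"
  by auto
termination
  by (relation "measure (\<lambda>(n, m). if m > 0 then nat m else nat (1 - m) + n)") auto

declare nfib.simps [simp del]

lemma nfib_base: "n \<ge> 2 \<Longrightarrow> 1 \<le> m \<Longrightarrow> m \<le> int n \<Longrightarrow> nfib n m = 1"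
  by (subst nfib.simps) simp

lemma nfib_rec:
  assumes "n \<ge> 2"
  shows "nfib n (m + 1) = nfib n m + nfib n (m + 1 - int n)"
proof (cases "m \<ge> int n")
  case True
  then show ?thesis using assms by (subst nfib.simps) simp
next
  case False
  then have "nfib n (m + 1 - int n) = nfib n (m + 1) - nfib n m"
    using assms by (subst nfib.simps) (simp add: algebra_simps)
  then show ?thesis by simp
qed

text \<open>
  The strings \<open>S\<^sub>m\<close> over the letters \<open>a 1, \<dots>, a n\<close>. Only \<open>m \<ge> 1\<close> and \<open>n \<ge> 1\<close> are
  meaningful; otherwise the value is the dummy \<open>[]\<close>.
\<close>

function nstr :: "(nat \<Rightarrow> 'a) \<Rightarrow> nat \<Rightarrow> nat \<Rightarrow> 'a list" where
  "nstr a n m =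
    (if n = 0 \<or> m = 0 then []
     else if m \<le> n then [a m]
     else nstr a n (m - 1) @ nstr a n (m - n))"
  by auto
termination
  by (relation "measure (\<lambda>(a, n, m). m)") auto

declare nstr.simps [simp del]

definition nstr_inf :: "(nat \<Rightarrow> 'a) \<Rightarrow> nat \<Rightarrow> 'a stream" where
  "nstr_inf a n =
    (THE w. \<forall>m\<ge>n. stake (length (nstr a n m)) w = nstr a n m)"

text \<open>The description defining \<^const>\<open>nstr_inf\<close> is proper:\<close>

lemma nstr_Suc: "n \<ge> 1 \<Longrightarrow> m \<ge> n \<Longrightarrow> nstr a n (Suc m) = nstr a n m @ nstr a n (Suc m - n)"
  by (subst nstr.simps) simp

lemma nstr_nonempty: "n \<ge> 1 \<Longrightarrow> m \<ge> 1 \<Longrightarrow> nstr a n m \<noteq> []"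
proof (induction m rule: less_induct)
  case (less m)
  then show ?case by (subst nstr.simps) auto
qed

lemma nstr_prefix:
  assumes "n \<ge> 1" "n \<le> m" "m \<le> k"
  shows "prefix (nstr a n m) (nstr a n k)"
  using assms(3)
proof (induction k rule: dec_induct)
  case (step k)
  have "prefix (nstr a n k) (nstr a n (Suc k))"
    using nstr_Suc[of n k a] assms step by simp
  then show ?case using step by (metis prefix_order.trans)
qed simp

lemma length_nstr_ge:
  assumes "n \<ge> 1"
  shows "length (nstr a n (n + k)) > k"
proof (induction k)
  case 0
  then show ?case using nstr_nonempty[of n n a] assms by simp
next
  case (Suc k)
  have "length (nstr a n (Suc k)) > 0"
    using nstr_nonempty[of n "Suc k" a] assms by simp
  moreover have "nstr a n (n + Suc k) = nstr a n (n + k) @ nstr a n (Suc k)"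
    using nstr_Suc[of n "n + k" a] assms by simp
  ultimately show ?case using Suc by (simp del: length_greater_0_conv)
qed

lemma nstr_inf_ex1:
  assumes n: "n \<ge> 1"
  shows "\<exists>!w. \<forall>m\<ge>n. stake (length (nstr a n m)) w = nstr a n m"
proof
  let ?w = "smap (\<lambda>k. nstr a n (n + k) ! k) nats"
  show "\<forall>m\<ge>n. stake (length (nstr a n m)) ?w = nstr a n m"
  proof (intro allI impI nth_equalityI)
    fix m i assume m: "n \<le> m" and i: "i < length (stake (length (nstr a n m)) ?w)"
    have *: "nstr a n (n + i) ! i = nstr a n m ! i"
    proof (cases "m \<le> n + i")
      case True
      then show ?thesis using nstr_prefix[OF n m True, of a] i
        by (auto simp: prefix_def nth_append)
    next
      case False
      then have "prefix (nstr a n (n + i)) (nstr a n m)" using n by (intro nstr_prefix) auto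
      then show ?thesis using length_nstr_ge[OF n, of i a]
        by (auto simp: prefix_def nth_append)
    qed
    then show "stake (length (nstr a n m)) ?w ! i = nstr a n m ! i"
      using i by simp
  qed simp
next
  fix w assume w: "\<forall>m\<ge>n. stake (length (nstr a n m)) w = nstr a n m"
  have "w !! k = nstr a n (n + k) ! k" for k
    using w[rule_format, of "n + k"] length_nstr_ge[OF n, of k a] by (metis le_add1 stake_nth)
  then have "smap (\<lambda>k. nstr a n (n + k) ! k) nats = w"
    unfolding smap_alt by simp
  then show "w = smap (\<lambda>k. nstr a n (n + k) ! k) nats" by (rule sym)
qed

lemma stake_nstr_inf:
  assumes "n \<ge> 1" "m \<ge> n"
  shows "stake (length (nstr a n m)) (nstr_inf a n) = nstr a n m"
  using theI'[OF nstr_inf_ex1[OF assms(1), of a]] assms(2) unfolding nstr_inf_def by blast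

end

theory Submission
  imports Defs
begin

text \<open>
  Both parts come from the recursion $S_{m+1} = S_m \circ S_{m+1-n}$.

  The length and the letter counts are additive under concatenation, so along the strings they
  satisfy the recurrence of the numbers $F_{n,m}$, and so does every shift
  $m \mapsto F_{n,m-c}$. Two solutions that agree for $1 \le m \le n$ agree for all $m \ge 1$
  (\<open>additive_nstr\<close>). For the letters the shift $c$ is found by continuing the sequence to the
  left: it is $0$ for $2-n \le m \le 0$, equal to $1$ at $m = 1-n$, and $0$ again for
  $3-2n \le m \le -n$. The initial strings $S_1, \dots, S_n$ are single letters, so the
  shift has to bring a window of $n$ consecutive values, a single $1$ among zeros, onto
  $1 \le m \le n$ with the $1$ at the index of the letter. For $a_n$ the $1$ is $F_{n,1}$,
  preceded by $n-1$ zeros; for $a_i$ with $i < n$ it is $F_{n,1-n}$, with $i-1$ zeros from the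
  lower block before it and $n-i$ zeros from the upper block after it.

  For the concatenation, put $k_m = n + (n-1)m$. These indices are spaced so that
  $k_m + 1 - n = k_{m-1}$, so two unfoldings of the recursion give
  $S_{k_m+2} = S_{k_m} \circ S_{k_{m-1}} \circ S_{k_{m-1}+1}$. The concatenation
  $T_m = S_{k_m} \circ \cdots \circ S_{k_0}$ begins with the same two factors, followed by
  $T_{m-2}$. Hence $T_m$ is a prefix of $S_{k_m+2}$ by induction in steps of two
  (\<open>prefix_nstr_chain\<close>). As a prefix of $S_\infty$ it is determined by its length, which the
  first part computes.
\<close>

lemma nfib_backward:
  assumes "n \<ge> 2"
  shows "nfib n m = nfib n (m + int n) - nfib n (m + int n - 1)"
  using nfib_rec[OF assms, of "m + int n - 1"] by simp

lemma nfib_first_gap: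
  assumes "n \<ge> 2" "2 - int n \<le> m" "m \<le> 0"
  shows "nfib n m = 0"
  using assms by (subst nfib_backward) (simp_all add: nfib_base)

lemma nfib_one_minus:
  assumes "n \<ge> 2"
  shows "nfib n (1 - int n) = 1"
  using assms by (subst nfib_backward) (simp_all add: nfib_base nfib_first_gap)

lemma nfib_second_gap:
  assumes "n \<ge> 2" "3 - 2 * int n \<le> m" "m \<le> - int n"
  shows "nfib n m = 0"
  using assms by (subst nfib_backward) (simp_all add: nfib_first_gap)

text \<open>
  An additive statistic of strings and a shift of $F_n$ obey the same recurrence of order $n$, so
  comparing them on the one-letter strings is enough.
\<close>

lemma additive_nstr:
  fixes f :: "'a list \<Rightarrow> int"
  assumes n: "n \<ge> 2"
    and additive: "\<And>xs ys. f (xs @ ys) = f xs + f ys"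
    and letters: "\<And>m. 1 \<le> m \<Longrightarrow> m \<le> n \<Longrightarrow> f [a m] = nfib n (int m - c)"
    and m: "m \<ge> 1"
  shows "f (nstr a n m) = nfib n (int m - c)"
  using m
proof (induction m rule: less_induct)
  case (less m)
  show ?case
  proof (cases "m \<le> n")
    case True
    then show ?thesis using less.prems n letters by (subst nstr.simps) simp
  next
    case False
    have "f (nstr a n m) = f (nstr a n (m - 1)) + f (nstr a n (m - n))"
      using False n by (subst nstr.simps) (simp add: additive)
    also have "\<dots> = nfib n (int (m - 1) - c) + nfib n (int (m - n) - c)"
      using less.IH False n by simp
    also have "\<dots> = nfib n (int m - c)"
      using nfib_rec[OF n, of "int m - c - 1"] False n by (simp add: of_nat_diff algebra_simps)
    finally show ?thesis .
  qed
qed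

lemma length_nstr:
  assumes "n \<ge> 2" "m \<ge> 1"
  shows "int (length (nstr a n m)) = nfib n (int m)"
  using additive_nstr[of n "\<lambda>xs. int (length xs)" a 0 m] assms by (simp add: nfib_base)

lemma count_last_letter_nstr:
  assumes "n \<ge> 2" "inj_on a {1..n}" "m \<ge> 1"
  shows "int (count_list (nstr a n m) (a n)) = nfib n (int m - (int n - 1))"
proof (rule additive_nstr)
  fix k assume k: "1 \<le> k" "k \<le> n"
  show "int (count_list [a k] (a n)) = nfib n (int k - (int n - 1))"
  proof (cases "k = n")
    case True
    then show ?thesis using assms by (simp add: nfib_base)
  next
    case False
    then have "a k \<noteq> a n" using k assms by (auto dest: inj_onD)
    then show ?thesis using k False assms by (simp add: nfib_first_gap)
  qed
qed (use assms in auto)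

lemma count_letter_nstr:
  assumes "n \<ge> 2" "inj_on a {1..n}" "m \<ge> 1" "1 \<le> i" "i < n"
  shows "int (count_list (nstr a n m) (a i)) = nfib n (int m - (int n + int i - 1))"
proof (rule additive_nstr)
  fix k assume k: "1 \<le> k" "k \<le> n"
  show "int (count_list [a k] (a i)) = nfib n (int k - (int n + int i - 1))"
  proof (cases k i rule: linorder_cases)
    case less
    then have "a k \<noteq> a i" using k assms by (auto dest: inj_onD)
    then show ?thesis using k less assms by (simp add: nfib_second_gap)
  next
    case equal
    then show ?thesis using assms by (simp add: nfib_one_minus)
  next
    case greater
    then have "a k \<noteq> a i" using k assms by (auto dest: inj_onD)
    then show ?thesis using k greater assms by (simp add: nfib_first_gap)
  qed
qed (use assms in auto)

abbreviation (input) nstr_chain :: "(nat \<Rightarrow> 'a) \<Rightarrow> nat \<Rightarrow> nat \<Rightarrow> 'a list" where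
  "nstr_chain a n m \<equiv> concat (map (\<lambda>t. nstr a n (n + (n - 1) * t)) (rev [0..<Suc m]))"

lemma nstr_chain_index_Suc:
  fixes n m :: nat
  assumes "n \<ge> 1"
  shows "Suc (n + (n - 1) * Suc m) - n = n + (n - 1) * m"
  using assms by simp

lemma nstr_chain_step:
  assumes "n \<ge> 1"
  shows "nstr a n (Suc (n + (n - 1) * Suc m))
    = nstr a n (n + (n - 1) * Suc m) @ nstr a n (n + (n - 1) * m)"
  using nstr_Suc[OF assms, of "n + (n - 1) * Suc m" a]
  unfolding nstr_chain_index_Suc[OF assms] by simp

text \<open>
  The bound $k_m + 2$ is the one that reproduces itself: after cancelling the two common factors,
  the induction hypothesis places $T_{m-2}$ inside $S_{k_{m-2}+2}$, and the gap
  $k_{m-1} - k_{m-2} = n - 1 \ge 1$ makes this a prefix of the remaining factor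
  $S_{k_{m-1}+1}$.
\<close>

lemma prefix_nstr_chain:
  assumes n: "n \<ge> 2"
  shows "prefix (nstr_chain a n m) (nstr a n (n + (n - 1) * m + 2))"
proof (induction m rule: induct_nat_012)
  case 0
  show ?case using n by (simp add: nstr_prefix)
next
  case 1
  have "nstr_chain a n (Suc 0) = nstr a n (Suc (n + (n - 1) * Suc 0))"
    using nstr_chain_step[of n a 0] n by simp
  moreover have "prefix \<dots> (nstr a n (n + (n - 1) * Suc 0 + 2))"
    using n by (intro nstr_prefix) auto
  ultimately show ?case by (simp only:)
next
  case (ge2 m)
  let ?k = "\<lambda>m. n + (n - 1) * m"
  have "prefix (nstr a n (?k m + 2)) (nstr a n (Suc (?k (Suc m))))"
    using n by (intro nstr_prefix) auto
  with ge2(1) have "prefix (nstr_chain a n m) (nstr a n (Suc (?k (Suc m))))"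
    by (rule prefix_order.trans)
  moreover have "nstr a n (?k (Suc (Suc m)) + 2)
      = nstr a n (?k (Suc (Suc m))) @ nstr a n (?k (Suc m)) @ nstr a n (Suc (?k (Suc m)))"
  proof -
    have "Suc (Suc (?k (Suc (Suc m)))) - n = Suc (?k (Suc m))"
      using n by simp
    then show ?thesis
      using nstr_Suc[of n "Suc (?k (Suc (Suc m)))" a] nstr_chain_step[of n a "Suc m"] n
      by simp
  qed
  moreover have "nstr_chain a n (Suc (Suc m))
      = nstr a n (?k (Suc (Suc m))) @ nstr a n (?k (Suc m)) @ nstr_chain a n m"
    by simp
  ultimately show ?case by (simp only: same_prefix_prefix)
qed

lemma length_nstr_chain:
  assumes "n \<ge> 2"
  shows "int (length (nstr_chain a n m)) = (\<Sum>t=0..m. nfib n (int (n + (n - 1) * t)))"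
proof (induction m)
  case 0
  show ?case using length_nstr[of n n a] assms by simp
next
  case (Suc m)
  have "int (length (nstr a n (n + (n - 1) * Suc m))) = nfib n (int (n + (n - 1) * Suc m))"
    using assms by (intro length_nstr) auto
  moreover have "nstr_chain a n (Suc m) = nstr a n (n + (n - 1) * Suc m) @ nstr_chain a n m"
    by simp
  ultimately show ?case using Suc.IH
    by (simp only: length_append of_nat_add sum.atLeast0_atMost_Suc add.commute)
qed

lemma prefix_nstr_eq_stake_nstr_inf:
  assumes "n \<ge> 1" "m \<ge> n" "prefix xs (nstr a n m)"
  shows "xs = stake (length xs) (nstr_inf a n)"
proof -
  have "length xs \<le> length (nstr a n m)"
    using assms(3) by (rule prefix_length_le)
  moreover have "xs = take (length xs) (stake (length (nstr a n m)) (nstr_inf a n))"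
    using assms by (auto simp: stake_nstr_inf prefix_def)
  ultimately show ?thesis by (simp add: take_stake min_def)
qed

theorem theorem1p3:
  fixes n :: nat and a :: "nat \<Rightarrow> 'a"
  assumes "n \<ge> 3" and "inj_on a {1..n}"
  shows "(\<forall>m::nat. m \<ge> 1 \<longrightarrow>
            int (length (nstr a n m)) = nfib n (int m)
          \<and> int (count_list (nstr a n m) (a n)) = nfib n (int m - (int n - 1))
          \<and> (\<forall>i::nat. 1 \<le> i \<and> i \<le> n - 1 \<longrightarrow>
                int (count_list (nstr a n m) (a i)) = nfib n (int m - (int n + int i - 1))))
       \<and> (\<forall>m::nat. m \<ge> 1 \<longrightarrow>
            concat (map (\<lambda>t. nstr a n (n + (n - 1) * t)) (rev [0..<Suc m]))
              = stake (nat (\<Sum>t=0..m. nfib n (int (n + (n - 1) * t)))) (nstr_inf a n))"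
proof (intro conjI allI impI)
  fix m :: nat assume m: "m \<ge> 1"
  show "int (length (nstr a n m)) = nfib n (int m)"
    using assms m by (intro length_nstr) auto
  show "int (count_list (nstr a n m) (a n)) = nfib n (int m - (int n - 1))"
    using assms m by (intro count_last_letter_nstr) auto
  fix i :: nat assume "1 \<le> i \<and> i \<le> n - 1"
  then show "int (count_list (nstr a n m) (a i)) = nfib n (int m - (int n + int i - 1))"
    using assms m by (intro count_letter_nstr) auto
next
  fix m :: nat
  have "nstr_chain a n m = stake (length (nstr_chain a n m)) (nstr_inf a n)"
    using assms by (intro prefix_nstr_eq_stake_nstr_inf[OF _ _ prefix_nstr_chain]) auto
  moreover have "length (nstr_chain a n m)
      = nat (\<Sum>t=0..m. nfib n (int (n + (n - 1) * t)))"
    using length_nstr_chain[of n a m] assms by linarith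
  ultimately show "nstr_chain a n m
      = stake (nat (\<Sum>t=0..m. nfib n (int (n + (n - 1) * t)))) (nstr_inf a n)"
    by metis
qed

end
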